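(* Let $(M,\phi,\xi,\eta,g)$ be a $(2n+1)$-dimensional Kenmotsu manifold, let $a>0$ be a constant, and let $(\overline{\phi},\overline{\xi},\overline{\eta},\overline{g})$ be the $D$-homothetically deformed structure on $M$. Let $f\in C^\infty(M)$. If $(V=\overline{\mathrm{grad}}(f),\overline{\lambda})$ defines a gradient almost Riemann soliton in $(M,\overline{g})$, then $$\overline{\lambda}=\frac{1}{2na}\Delta(f)-\frac{a-1}{a^2}\eta(\mathrm{grad}(f))+\frac{2n-a}{2na^2}\mathrm{Hess}(f)(\xi,\xi)-\frac{1}{a^2}.$$
   Context: An almost contact metric manifold $(M,\phi,\xi,\eta,g)$ is an odd-dimensional Riemannian manifold $(M,g)$, here of dimension $2n+1$ with $n\ge 1$, together with a $(1,1)$-tensor field $\phi$, a vector field $\xi$ (the Reeb vector field) and a $1$-form $\eta$ such that $\phi^2=-I+\eta\otimes\xi$, $\eta(\xi)=1$, $\eta=g(\xi,\cdot)$ and $g(\phi X,\phi Y)=g(X,Y)-\eta(X)\eta(Y)$. It is a Kenmotsu manifold if the Levi-Civita connection $\nabla$ of $g$ satisfies $(\nabla_X\phi)Y=g(\phi X,Y)\xi-\eta(Y)\phi X$ for all vector fields $X,Y$. For a constant $a>0$, the $D$-homothetically deformed structure is $\overline{\phi}=\phi$, $\overline{\xi}=\frac{1}{a}\xi$, $\overline{\eta}=a\eta$, $\overline{g}=ag+a(a-1)\eta\otimes\eta$. For a Riemannian metric $h$, a nowhere-vanishing vector field $V$ and a smooth function $\lambda$ on $M$, the pair $(V,\lambda)$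 defines an almost Riemann soliton in $(M,h)$ if $\frac12\mathcal{L}_Vh\odot h+R_h=\frac{\lambda}{2}\,h\odot h$; it is called gradient if $V$ is the $h$-gradient of a smooth function. Here $\mathcal{L}$ is the Lie derivative; $R_h(X,Y,Z,W)=h(R_h(X,Y)Z,W)$ with $R_h(X,Y)Z=\nabla^h_X\nabla^h_YZ-\nabla^h_Y\nabla^h_XZ-\nabla^h_{[X,Y]}Z$; and for $(0,2)$-tensors $(T_1\odot T_2)(X,Y,Z,W)=T_1(X,W)T_2(Y,Z)+T_1(Y,Z)T_2(X,W)-T_1(X,Z)T_2(Y,W)-T_1(Y,W)T_2(X,Z)$. $\mathrm{grad},\mathrm{Hess},\Delta$ are the gradient, Hessian and Laplace operator ($\Delta=\mathrm{div}\circ\mathrm{grad}$) of $g$; $\overline{\mathrm{grad}}$ is the gradient with respect to $\overline{g}$. *)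

theory Defs
  imports "HOL-Analysis.Analysis"
begin

section \<open>Smooth maps between open subsets of normed spaces\<close>

text \<open>Only used for open \<open>S\<close> in a Euclidean space, where it is the usual class of
  \<open>k\<close> times continuously differentiable maps.\<close>

fun Ck_on :: "nat \<Rightarrow> 'a::real_normed_vector set \<Rightarrow> ('a \<Rightarrow> 'b::real_normed_vector) \<Rightarrow> bool" where
  "Ck_on 0 S f \<longleftrightarrow> continuous_on S f"
| "Ck_on (Suc k) S f \<longleftrightarrow>
     f differentiable_on S \<and> (\<forall>v. Ck_on k S (\<lambda>x. frechet_derivative f (at x) v))"

definition smooth_on :: "'a::real_normed_vector set \<Rightarrow> ('a \<Rightarrow> 'b::real_normed_vector) \<Rightarrow> bool" where
  "smooth_on S f \<longleftrightarrow> (\<forall>k. Ck_on k S f)"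


section \<open>Smooth manifolds\<close>

text \<open>The manifold is the whole (Hausdorff, second countable) type \<open>'m\<close>, modelled on the
  Euclidean space \<open>'e\<close>. A chart is a pair of its domain and its coordinate map; the values of
  the coordinate map outside the domain are irrelevant. The atlas need not be maximal.\<close>

type_synonym ('m, 'e) chart = "'m set \<times> ('m \<Rightarrow> 'e)"

abbreviation dom_chart :: "('m, 'e) chart \<Rightarrow> 'm set" where
  "dom_chart c \<equiv> fst c"

abbreviation map_chart :: "('m, 'e) chart \<Rightarrow> 'm \<Rightarrow> 'e" where
  "map_chart c \<equiv> snd c"

definition inv_chart :: "('m, 'e) chart \<Rightarrow> 'e \<Rightarrow> 'm" where
  "inv_chart c = inv_into (dom_chart c) (map_chart c)"

definition smooth_atlas ::
  "('m::{t2_space, second_countable_topology}, 'e::euclidean_space) chart set \<Rightarrow> bool" where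
  "smooth_atlas A \<longleftrightarrow>
     (\<forall>c\<in>A. open (dom_chart c) \<and> open (map_chart c ` dom_chart c) \<and>
        homeomorphism (dom_chart c) (map_chart c ` dom_chart c) (map_chart c) (inv_chart c)) \<and>
     (\<Union>c\<in>A. dom_chart c) = UNIV \<and>
     (\<forall>c\<in>A. \<forall>c'\<in>A. smooth_on (map_chart c ` (dom_chart c \<inter> dom_chart c'))
        (map_chart c' \<circ> inv_chart c))"

text \<open>The tangent space at every point \<open>p\<close> is represented by \<open>'e\<close>: a tangent vector at \<open>p\<close> is
  given by its components in one fixed chart \<open>chart_at A p\<close> around \<open>p\<close>. Its components in any
  other chart \<open>c\<close> around \<open>p\<close> are obtained by applying the differential of the transition map;
  this is \<open>components A c p\<close>. Since the chosen chart varies with \<open>p\<close> in an arbitrary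
  way, smoothness of a vector field always refers to its components in the charts of the atlas,
  never to the function into \<open>'e\<close> representing it.\<close>

definition chart_at :: "('m, 'e) chart set \<Rightarrow> 'm \<Rightarrow> ('m, 'e) chart" where
  "chart_at A p = (SOME c. c \<in> A \<and> p \<in> dom_chart c)"

definition components ::
  "('m, 'e::euclidean_space) chart set \<Rightarrow> ('m, 'e) chart \<Rightarrow> 'm \<Rightarrow> 'e \<Rightarrow> 'e" where
  "components A c p v =
     frechet_derivative (map_chart c \<circ> inv_chart (chart_at A p)) (at (map_chart (chart_at A p) p)) v"

definition smooth_fun_on ::
  "('m::topological_space, 'e::euclidean_space) chart set \<Rightarrow> 'm set \<Rightarrow> ('m \<Rightarrow> real) \<Rightarrow> bool" where
  "smooth_fun_on A U f \<longleftrightarrow>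
     open U \<and> (\<forall>c\<in>A. smooth_on (map_chart c ` (U \<inter> dom_chart c)) (f \<circ> inv_chart c))"

abbreviation smooth_fun ::
  "('m::topological_space, 'e::euclidean_space) chart set \<Rightarrow> ('m \<Rightarrow> real) \<Rightarrow> bool" where
  "smooth_fun A f \<equiv> smooth_fun_on A UNIV f"

definition vf_rep ::
  "('m, 'e::euclidean_space) chart set \<Rightarrow> ('m, 'e) chart \<Rightarrow> ('m \<Rightarrow> 'e) \<Rightarrow> 'e \<Rightarrow> 'e" where
  "vf_rep A c X = (\<lambda>x. components A c (inv_chart c x) (X (inv_chart c x)))"

text \<open>Smooth vector fields on an open subset \<open>U\<close>. As usual, connections are regarded as acting
  on local vector fields as well, and identities between tensor fields are tested on local
  vector fields.\<close>

definition vector_field_on ::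
  "('m::topological_space, 'e::euclidean_space) chart set \<Rightarrow> 'm set \<Rightarrow> ('m \<Rightarrow> 'e) \<Rightarrow> bool" where
  "vector_field_on A U X \<longleftrightarrow>
     open U \<and> (\<forall>c\<in>A. smooth_on (map_chart c ` (U \<inter> dom_chart c)) (vf_rep A c X))"

abbreviation vector_field ::
  "('m::topological_space, 'e::euclidean_space) chart set \<Rightarrow> ('m \<Rightarrow> 'e) \<Rightarrow> bool" where
  "vector_field A X \<equiv> vector_field_on A UNIV X"

definition differential ::
  "('m, 'e::euclidean_space) chart set \<Rightarrow> ('m \<Rightarrow> real) \<Rightarrow> 'm \<Rightarrow> 'e \<Rightarrow> real" where
  "differential A f p v =
     frechet_derivative (f \<circ> inv_chart (chart_at A p)) (at (map_chart (chart_at A p) p)) v"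

text \<open>The coordinate expression \<open>[X,Y] = DY(X) - DX(Y)\<close>, in the chart which also represents the
  tangent vectors at \<open>p\<close>.\<close>

definition lie_bracket ::
  "('m, 'e::euclidean_space) chart set \<Rightarrow> ('m \<Rightarrow> 'e) \<Rightarrow> ('m \<Rightarrow> 'e) \<Rightarrow> 'm \<Rightarrow> 'e" where
  "lie_bracket A X Y = (\<lambda>p. let c = chart_at A p; x = map_chart c p in
     frechet_derivative (vf_rep A c Y) (at x) (X p) - frechet_derivative (vf_rep A c X) (at x) (Y p))"


section \<open>Tensor fields, metrics and connections\<close>

definition one_form ::
  "('m::topological_space, 'e::euclidean_space) chart set \<Rightarrow> ('m \<Rightarrow> 'e \<Rightarrow> real) \<Rightarrow> bool" where
  "one_form A \<eta> \<longleftrightarrow> (\<forall>p. linear (\<eta> p)) \<and>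
     (\<forall>U X. vector_field_on A U X \<longrightarrow> smooth_fun_on A U (\<lambda>p. \<eta> p (X p)))"

definition endomorphism_field ::
  "('m::topological_space, 'e::euclidean_space) chart set \<Rightarrow> ('m \<Rightarrow> 'e \<Rightarrow> 'e) \<Rightarrow> bool" where
  "endomorphism_field A \<phi> \<longleftrightarrow> (\<forall>p. linear (\<phi> p)) \<and>
     (\<forall>U X. vector_field_on A U X \<longrightarrow> vector_field_on A U (\<lambda>p. \<phi> p (X p)))"

definition riemannian_metric ::
  "('m::topological_space, 'e::euclidean_space) chart set \<Rightarrow> ('m \<Rightarrow> 'e \<Rightarrow> 'e \<Rightarrow> real) \<Rightarrow> bool" where
  "riemannian_metric A h \<longleftrightarrow>
     (\<forall>p. bilinear (h p)) \<and> (\<forall>p u v. h p u v = h p v u) \<and> (\<forall>p v. v \<noteq> 0 \<longrightarrow> h p v v > 0) \<and>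
     (\<forall>U X Y. vector_field_on A U X \<and> vector_field_on A U Y \<longrightarrow>
        smooth_fun_on A U (\<lambda>p. h p (X p) (Y p)))"

text \<open>A connection \<open>D\<close> assigns to a vector field \<open>Y\<close> near \<open>p\<close> and a tangent vector \<open>v\<close> at \<open>p\<close> the
  covariant derivative \<open>D Y p v\<close> of \<open>Y\<close> at \<open>p\<close> in the direction \<open>v\<close>.\<close>

type_synonym ('m, 'e) connection = "('m \<Rightarrow> 'e) \<Rightarrow> 'm \<Rightarrow> 'e \<Rightarrow> 'e"

definition cov :: "('m, 'e) connection \<Rightarrow> ('m \<Rightarrow> 'e) \<Rightarrow> ('m \<Rightarrow> 'e) \<Rightarrow> 'm \<Rightarrow> 'e" where
  "cov D X Y = (\<lambda>p. D Y p (X p))"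

definition affine_connection ::
  "('m::topological_space, 'e::euclidean_space) chart set \<Rightarrow> ('m, 'e) connection \<Rightarrow> bool" where
  "affine_connection A D \<longleftrightarrow>
     (\<forall>U Y. vector_field_on A U Y \<longrightarrow> (\<forall>p\<in>U. linear (D Y p))) \<and>
     (\<forall>U Y Z. vector_field_on A U Y \<and> vector_field_on A U Z \<longrightarrow>
        (\<forall>p\<in>U. \<forall>v. D (\<lambda>q. Y q + Z q) p v = D Y p v + D Z p v)) \<and>
     (\<forall>U f Y. smooth_fun_on A U f \<and> vector_field_on A U Y \<longrightarrow>
        (\<forall>p\<in>U. \<forall>v. D (\<lambda>q. f q *\<^sub>R Y q) p v = differential A f p v *\<^sub>R Y p + f p *\<^sub>R D Y p v)) \<and>
     (\<forall>U X Y. vector_field_on A U X \<and> vector_field_on A U Y \<longrightarrow> vector_field_on A U (cov D X Y))"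

definition levi_civita ::
  "('m::topological_space, 'e::euclidean_space) chart set \<Rightarrow> ('m \<Rightarrow> 'e \<Rightarrow> 'e \<Rightarrow> real) \<Rightarrow>
     ('m, 'e) connection \<Rightarrow> bool" where
  "levi_civita A h D \<longleftrightarrow> affine_connection A D \<and>
     (\<forall>U X Y. vector_field_on A U X \<and> vector_field_on A U Y \<longrightarrow>
        (\<forall>p\<in>U. cov D X Y p - cov D Y X p = lie_bracket A X Y p)) \<and>
     (\<forall>U X Y Z. vector_field_on A U X \<and> vector_field_on A U Y \<and> vector_field_on A U Z \<longrightarrow>
        (\<forall>p\<in>U. differential A (\<lambda>q. h q (Y q) (Z q)) p (X p) =
           h p (cov D X Y p) (Z p) + h p (Y p) (cov D X Z p)))"

definition grad ::
  "('m, 'e::euclidean_space) chart set \<Rightarrow> ('m \<Rightarrow> 'e \<Rightarrow> 'e \<Rightarrow> real) \<Rightarrow> ('m \<Rightarrow> real) \<Rightarrow> 'm \<Rightarrow> 'e" where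
  "grad A h f p = (THE w. \<forall>v. h p w v = differential A f p v)"

definition divergence :: "('m, 'e::euclidean_space) connection \<Rightarrow> ('m \<Rightarrow> 'e) \<Rightarrow> 'm \<Rightarrow> real" where
  "divergence D V p = (\<Sum>b\<in>Basis. D V p b \<bullet> b)" \<comment> \<open>the trace of \<open>v \<mapsto> D V p v\<close>; the auxiliary inner product of \<open>'e\<close> only serves to express the trace\<close>

text \<open>In the following two definitions \<open>D\<close> is meant to be the Levi-Civita connection of \<open>h\<close>.\<close>

definition hess ::
  "('m, 'e::euclidean_space) chart set \<Rightarrow> ('m \<Rightarrow> 'e \<Rightarrow> 'e \<Rightarrow> real) \<Rightarrow> ('m, 'e) connection \<Rightarrow>
     ('m \<Rightarrow> real) \<Rightarrow> 'm \<Rightarrow> 'e \<Rightarrow> 'e \<Rightarrow> real" where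
  "hess A h D f p u v = h p (D (grad A h f) p u) v"

definition laplacian ::
  "('m, 'e::euclidean_space) chart set \<Rightarrow> ('m \<Rightarrow> 'e \<Rightarrow> 'e \<Rightarrow> real) \<Rightarrow> ('m, 'e) connection \<Rightarrow>
     ('m \<Rightarrow> real) \<Rightarrow> 'm \<Rightarrow> real" where
  "laplacian A h D f = divergence D (grad A h f)"

definition curvature ::
  "('m, 'e::euclidean_space) chart set \<Rightarrow> ('m, 'e) connection \<Rightarrow>
     ('m \<Rightarrow> 'e) \<Rightarrow> ('m \<Rightarrow> 'e) \<Rightarrow> ('m \<Rightarrow> 'e) \<Rightarrow> 'm \<Rightarrow> 'e" where
  "curvature A D X Y Z = (\<lambda>p. cov D X (cov D Y Z) p - cov D Y (cov D X Z) p
     - cov D (lie_bracket A X Y) Z p)"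


section \<open>Almost Riemann solitons\<close>

text \<open>Here (0,2)-tensor fields are operators taking two vector fields to a function;
  \<open>as_tensor h\<close> turns a pointwise bilinear form into such an operator.\<close>

type_synonym ('m, 'e) tensor2 = "('m \<Rightarrow> 'e) \<Rightarrow> ('m \<Rightarrow> 'e) \<Rightarrow> 'm \<Rightarrow> real"

definition as_tensor :: "('m \<Rightarrow> 'e \<Rightarrow> 'e \<Rightarrow> real) \<Rightarrow> ('m, 'e) tensor2" where
  "as_tensor h X Y = (\<lambda>p. h p (X p) (Y p))"

definition lie_derivative ::
  "('m, 'e::euclidean_space) chart set \<Rightarrow> ('m \<Rightarrow> 'e) \<Rightarrow> ('m \<Rightarrow> 'e \<Rightarrow> 'e \<Rightarrow> real) \<Rightarrow> ('m, 'e) tensor2" where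
  "lie_derivative A V h X Y = (\<lambda>p. differential A (as_tensor h X Y) p (V p)
     - as_tensor h (lie_bracket A V X) Y p - as_tensor h X (lie_bracket A V Y) p)"

definition kulkarni_nomizu ::
  "('m, 'e) tensor2 \<Rightarrow> ('m, 'e) tensor2 \<Rightarrow>
     ('m \<Rightarrow> 'e) \<Rightarrow> ('m \<Rightarrow> 'e) \<Rightarrow> ('m \<Rightarrow> 'e) \<Rightarrow> ('m \<Rightarrow> 'e) \<Rightarrow> 'm \<Rightarrow> real" where
  "kulkarni_nomizu T\<^sub>1 T\<^sub>2 X Y Z W = (\<lambda>p.
     T\<^sub>1 X W p * T\<^sub>2 Y Z p + T\<^sub>1 Y Z p * T\<^sub>2 X W p - T\<^sub>1 X Z p * T\<^sub>2 Y W p - T\<^sub>1 Y W p * T\<^sub>2 X Z p)"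

definition almost_riemann_soliton ::
  "('m::topological_space, 'e::euclidean_space) chart set \<Rightarrow> ('m \<Rightarrow> 'e \<Rightarrow> 'e \<Rightarrow> real) \<Rightarrow>
     ('m, 'e) connection \<Rightarrow> ('m \<Rightarrow> 'e) \<Rightarrow> ('m \<Rightarrow> real) \<Rightarrow> bool" where
  "almost_riemann_soliton A h D V lam \<longleftrightarrow>
     riemannian_metric A h \<and> levi_civita A h D \<and>
     vector_field A V \<and> (\<forall>p. V p \<noteq> 0) \<and> smooth_fun A lam \<and>
     (\<forall>U X Y Z W. vector_field_on A U X \<and> vector_field_on A U Y \<and>
         vector_field_on A U Z \<and> vector_field_on A U W \<longrightarrow>
       (\<forall>p\<in>U. kulkarni_nomizu (\<lambda>X Y p. 1/2 * lie_derivative A V h X Y p) (as_tensor h) X Y Z W p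
           + h p (curvature A D X Y Z p) (W p)
         = lam p / 2 * kulkarni_nomizu (as_tensor h) (as_tensor h) X Y Z W p))"


section \<open>Kenmotsu manifolds and D-homothetic deformations\<close>

definition almost_contact_metric ::
  "('m::topological_space, 'e::euclidean_space) chart set \<Rightarrow> ('m \<Rightarrow> 'e \<Rightarrow> 'e) \<Rightarrow> ('m \<Rightarrow> 'e) \<Rightarrow>
     ('m \<Rightarrow> 'e \<Rightarrow> real) \<Rightarrow> ('m \<Rightarrow> 'e \<Rightarrow> 'e \<Rightarrow> real) \<Rightarrow> bool" where
  "almost_contact_metric A \<phi> \<xi> \<eta> g \<longleftrightarrow>
     riemannian_metric A g \<and> endomorphism_field A \<phi> \<and> vector_field A \<xi> \<and> one_form A \<eta> \<and>
     (\<forall>p v. \<phi> p (\<phi> p v) = - v + \<eta> p v *\<^sub>R \<xi> p) \<and>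
     (\<forall>p. \<eta> p (\<xi> p) = 1) \<and>
     (\<forall>p v. \<eta> p v = g p (\<xi> p) v) \<and>
     (\<forall>p u v. g p (\<phi> p u) (\<phi> p v) = g p u v - \<eta> p u * \<eta> p v)"

text \<open>\<open>(\<nabla>\<^sub>X \<phi>) Y = \<nabla>\<^sub>X (\<phi> Y) - \<phi> (\<nabla>\<^sub>X Y)\<close>\<close>

definition cov_endo ::
  "('m, 'e::euclidean_space) connection \<Rightarrow> ('m \<Rightarrow> 'e) \<Rightarrow> ('m \<Rightarrow> 'e \<Rightarrow> 'e) \<Rightarrow> ('m \<Rightarrow> 'e) \<Rightarrow> 'm \<Rightarrow> 'e" where
  "cov_endo D X \<phi> Y = (\<lambda>p. cov D X (\<lambda>q. \<phi> q (Y q)) p - \<phi> p (cov D X Y p))"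

definition kenmotsu ::
  "('m::topological_space, 'e::euclidean_space) chart set \<Rightarrow> ('m \<Rightarrow> 'e \<Rightarrow> 'e) \<Rightarrow> ('m \<Rightarrow> 'e) \<Rightarrow>
     ('m \<Rightarrow> 'e \<Rightarrow> real) \<Rightarrow> ('m \<Rightarrow> 'e \<Rightarrow> 'e \<Rightarrow> real) \<Rightarrow> ('m, 'e) connection \<Rightarrow> bool" where
  "kenmotsu A \<phi> \<xi> \<eta> g D \<longleftrightarrow>
     almost_contact_metric A \<phi> \<xi> \<eta> g \<and> levi_civita A g D \<and>
     (\<forall>U X Y. vector_field_on A U X \<and> vector_field_on A U Y \<longrightarrow>
       (\<forall>p\<in>U. cov_endo D X \<phi> Y p = g p (\<phi> p (X p)) (Y p) *\<^sub>R \<xi> p - \<eta> p (Y p) *\<^sub>R \<phi> p (X p)))"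

definition d_homothetic ::
  "real \<Rightarrow> ('m \<Rightarrow> 'e \<Rightarrow> 'e) \<times> ('m \<Rightarrow> 'e::real_vector) \<times> ('m \<Rightarrow> 'e \<Rightarrow> real) \<times> ('m \<Rightarrow> 'e \<Rightarrow> 'e \<Rightarrow> real) \<Rightarrow>
     ('m \<Rightarrow> 'e \<Rightarrow> 'e) \<times> ('m \<Rightarrow> 'e) \<times> ('m \<Rightarrow> 'e \<Rightarrow> real) \<times> ('m \<Rightarrow> 'e \<Rightarrow> 'e \<Rightarrow> real)" where
  "d_homothetic a = (\<lambda>(\<phi>, \<xi>, \<eta>, g).
     (\<phi>, \<lambda>p. (1/a) *\<^sub>R \<xi> p, \<lambda>p v. a * \<eta> p v,
      \<lambda>p u v. a * g p u v + a * (a - 1) * \<eta> p u * \<eta> p v))"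

end

theory Submission
  imports Defs
begin

text \<open>Write \<open>\<nabla>\<close>, \<open>\<nabla>'\<close> for the Levi-Civita connections of \<open>g\<close> and of the deformed metric \<open>g'\<close>, and call a
  vector \<open>v\<close> horizontal if \<open>\<eta>(v) = 0\<close>. The idea is to evaluate the soliton equation at
  \<open>(v, \<xi>, \<xi>, v)\<close> with \<open>v\<close> horizontal and to take the trace over \<open>v\<close>; the resulting scalar equation
  determines the soliton function \<open>\<lambda>\<close>.

  On a Kenmotsu manifold \<open>\<nabla>\<^sub>v \<xi> = v - \<eta>(v) \<xi>\<close> (lemma \<open>D_\<xi>\<close>), hence
  \<open>(\<nabla>\<^sub>X \<eta>)(Y) = g(X,Y) - \<eta>(X) \<eta>(Y)\<close>. As \<open>g'\<close> is built from \<open>g\<close> and \<open>\<eta>\<close>, this gives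
  \<open>\<nabla>'\<^sub>X Y = \<nabla>\<^sub>X Y + ((a - 1) / a) (g(X,Y) - \<eta>(X) \<eta>(Y)) \<xi>\<close> (\<open>deformed_connection\<close>). The correction vanishes
  when \<open>X\<close> or \<open>Y\<close> is \<open>\<xi>\<close>, so \<open>\<nabla>'\<xi> = \<nabla>\<xi>\<close>, and from this \<open>R'(v,\<xi>)\<xi> = - v\<close> for horizontal \<open>v\<close>
  (\<open>deformed_curvature_\<xi>\<close>). For a gradient field half the Lie derivative of the metric, on the diagonal, is the
  Hessian, and the Hessians of \<open>f\<close> for the two metrics differ by the same correction applied to \<open>df\<close>
  (\<open>deformed_hessian\<close>).

  Inserting all this, the soliton equation at \<open>(v, \<xi>, \<xi>, v)\<close> becomes \<open>Hess f (v,v) = \<mu> g(v,v)\<close> for horizontal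
  \<open>v\<close>, where \<open>\<mu> = a \<lambda> + ((a - 1) / a) \<eta>(grad f) - Hess f (\<xi>,\<xi>) / a + 1 / a\<close> (\<open>soliton_horizontal\<close>).
  The horizontal space has dimension \<open>2n\<close>, so \<open>\<Delta> f = 2n \<mu> + Hess f (\<xi>,\<xi>)\<close>
  (\<open>trace_of_horizontally_scalar\<close>), and solving for \<open>\<lambda>\<close> gives the formula.

  Identities between tensors are tested on local vector fields, hence tangent vectors have to be extended to
  such fields (\<open>local_vector_field\<close>). That the extension is smooth in every chart rests on the chain
  rule and on the closure of smooth maps under composition.\<close>

section \<open>Calculus of smooth maps\<close>

lemma frechet_derivative_cong_open:
  assumes "open S" "x \<in> S" "\<And>y. y \<in> S \<Longrightarrow> f y = g y"
  shows "frechet_derivative f (at x) = frechet_derivative g (at x)"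
proof -
  have "(f has_derivative f') (at x) \<longleftrightarrow> (g has_derivative f') (at x)" for f'
    using has_derivative_transform_within_open[OF _ assms(1,2), of f f' UNIV g]
      has_derivative_transform_within_open[OF _ assms(1,2), of g f' UNIV f] assms(3)
    by auto
  then show ?thesis by (simp add: frechet_derivative_def)
qed

lemma Ck_on_cong:
  assumes "open S" "\<And>y. y \<in> S \<Longrightarrow> f y = g y" "Ck_on k S f"
  shows "Ck_on k S g"
  using assms
proof (induction k arbitrary: f g)
  case 0
  then show ?case by (simp cong: continuous_on_cong)
next
  case (Suc k)
  have "g differentiable_on S"
    using Suc.prems differentiable_transform_within[of f _ S 1 g] by (auto simp: differentiable_on_def)
  moreover have "Ck_on k S (\<lambda>x. frechet_derivative g (at x) v)" for v
    using Suc.IH[of "\<lambda>x. frechet_derivative f (at x) v" "\<lambda>x. frechet_derivative g (at x) v"] Suc.prems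
      frechet_derivative_cong_open[OF Suc.prems(1), of _ f g]
    by simp
  ultimately show ?case by simp
qed

lemma Ck_on_subset: "Ck_on k S f \<Longrightarrow> T \<subseteq> S \<Longrightarrow> Ck_on k T f"
  by (induction k arbitrary: f) (auto intro: continuous_on_subset differentiable_on_subset)

lemma Ck_on_SucD: "Ck_on (Suc k) S f \<Longrightarrow> Ck_on k S f"
  by (induction k arbitrary: f) (auto intro: differentiable_imp_continuous_on)

lemma Ck_on_Suc_has_derivative:
  assumes "open S" "Ck_on (Suc k) S f" "x \<in> S"
  shows "(f has_derivative frechet_derivative f (at x)) (at x)"
  using assms by (auto simp: differentiable_on_eq_differentiable_at frechet_derivative_works[symmetric])

lemma Ck_on_const: "Ck_on k S (\<lambda>x. c)"
  by (induction k arbitrary: c) (auto simp: frechet_derivative_const)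

lemma Ck_on_SucI:
  assumes "open S" "\<And>x. x \<in> S \<Longrightarrow> (f has_derivative F x) (at x)" "\<And>v. Ck_on k S (\<lambda>x. F x v)"
  shows "Ck_on (Suc k) S f"
proof -
  have "Ck_on k S (\<lambda>x. frechet_derivative f (at x) v)" for v
    by (rule Ck_on_cong[OF assms(1) _ assms(3)[of v]])
      (metis assms(2) frechet_derivative_at)
  then show ?thesis
    using assms(1,2) by (auto simp: differentiable_on_eq_differentiable_at differentiable_def)
qed

lemma Ck_on_add:
  assumes "open S" "Ck_on k S f" "Ck_on k S g"
  shows "Ck_on k S (\<lambda>x. f x + g x)"
  using assms
proof (induction k arbitrary: f g)
  case 0
  then show ?case by (simp add: continuous_on_add)
next
  case (Suc k)
  have der: "((\<lambda>x. f x + g x) has_derivative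
      (\<lambda>v. frechet_derivative f (at x) v + frechet_derivative g (at x) v)) (at x)" if "x \<in> S" for x
    using Suc.prems that by (intro has_derivative_add Ck_on_Suc_has_derivative[of S k])
  show ?case
    using Suc by (intro Ck_on_SucI[OF Suc.prems(1) der]) auto
qed

lemma Ck_on_scaleR:
  fixes f :: "'a::real_normed_vector \<Rightarrow> real" and g :: "'a \<Rightarrow> 'b::real_normed_vector"
  assumes "open S" "Ck_on k S f" "Ck_on k S g"
  shows "Ck_on k S (\<lambda>x. f x *\<^sub>R g x)"
  using assms
proof (induction k arbitrary: f g)
  case 0
  then show ?case by (simp add: continuous_on_scaleR)
next
  case (Suc k)
  have der: "((\<lambda>x. f x *\<^sub>R g x) has_derivative
      (\<lambda>v. f x *\<^sub>R frechet_derivative g (at x) v + frechet_derivative f (at x) v *\<^sub>R g x)) (at x)"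
    if "x \<in> S" for x
    using Suc.prems that by (intro has_derivative_scaleR Ck_on_Suc_has_derivative[of S k])
  have "Ck_on k S f" "Ck_on k S g"
    using Suc.prems Ck_on_SucD by blast+
  with Suc show ?case
    by (intro Ck_on_SucI[OF Suc.prems(1) der] Ck_on_add) auto
qed

lemma Ck_on_linear:
  assumes "open S" "bounded_linear L" "Ck_on k S f"
  shows "Ck_on k S (\<lambda>x. L (f x))"
  using assms(3)
proof (induction k arbitrary: f)
  case 0
  then show ?case
    using assms(2) by (simp add: linear_continuous_on_compose linear_linear bounded_linear.continuous_on)
next
  case (Suc k)
  have der: "((\<lambda>x. L (f x)) has_derivative (\<lambda>v. L (frechet_derivative f (at x) v))) (at x)"
    if "x \<in> S" for x
    by (intro bounded_linear.has_derivative[OF assms(2)] Ck_on_Suc_has_derivative[OF assms(1) Suc.prems that])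
  show ?case
    using Suc by (intro Ck_on_SucI[OF assms(1) der]) auto
qed

lemma Ck_on_sum:
  assumes "open S" "finite I" "\<And>i. i \<in> I \<Longrightarrow> Ck_on k S (f i)"
  shows "Ck_on k S (\<lambda>x. \<Sum>i\<in>I. f i x)"
  using assms(2,3)
  by (induction I rule: finite_induct) (auto intro: Ck_on_const Ck_on_add[OF assms(1)])

lemma linear_Basis_expansion:
  fixes L :: "'a::euclidean_space \<Rightarrow> 'b::real_vector"
  assumes "linear L"
  shows "L w = (\<Sum>b\<in>Basis. (w \<bullet> b) *\<^sub>R L b)"
proof -
  have "L w = L (\<Sum>b\<in>Basis. (w \<bullet> b) *\<^sub>R b)"
    by (simp only: euclidean_representation)
  then show ?thesis
    by (simp only: linear_sum[OF assms] linear_scale[OF assms])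
qed

text \<open>A derivative of \<open>f \<circ> g\<close> is a combination of the directional derivatives of \<open>f\<close> along a
  basis, composed with \<open>g\<close>, so that only products and compositions of lower order are left.\<close>

lemma Ck_on_compose:
  fixes g :: "'a::real_normed_vector \<Rightarrow> 'b::euclidean_space" and f :: "'b \<Rightarrow> 'c::real_normed_vector"
  assumes "open S" "open T" "g ` S \<subseteq> T" "Ck_on k S g" "Ck_on k T f"
  shows "Ck_on k S (f \<circ> g)"
  using assms(4,5)
proof (induction k arbitrary: f)
  case 0
  then show ?case
    using assms(3) continuous_on_compose2[of T f S g] by (simp add: o_def)
next
  case (Suc k)
  let ?F = "\<lambda>x v. \<Sum>b\<in>Basis. (frechet_derivative g (at x) v \<bullet> b) *\<^sub>R frechet_derivative f (at (g x)) b"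
  have der: "((f \<circ> g) has_derivative ?F x) (at x)" if "x \<in> S" for x
  proof -
    have "g x \<in> T" using that assms(3) by auto
    then have f: "(f has_derivative frechet_derivative f (at (g x))) (at (g x))"
      and g: "(g has_derivative frechet_derivative g (at x)) (at x)"
      using Ck_on_Suc_has_derivative[OF assms(2) Suc.prems(2)]
        Ck_on_Suc_has_derivative[OF assms(1) Suc.prems(1) that] by blast+
    have "frechet_derivative f (at (g x)) \<circ> frechet_derivative g (at x) = ?F x"
      by (rule ext) (simp only: o_apply, rule linear_Basis_expansion[OF has_derivative_linear[OF f]])
    then show ?thesis
      using diff_chain_at[OF g f] by metis
  qed
  have "Ck_on k S (\<lambda>x. frechet_derivative f (at (g x)) b)" for b
    using Suc.IH[of "\<lambda>y. frechet_derivative f (at y) b"] Suc.prems Ck_on_SucD by (auto simp: o_def)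
  moreover have "Ck_on k S (\<lambda>x. frechet_derivative g (at x) v \<bullet> b)" for v b
    using Ck_on_linear[OF assms(1) bounded_linear_inner_left] Suc.prems by auto
  ultimately show ?case
    by (intro Ck_on_SucI[OF assms(1) der] Ck_on_sum[OF assms(1)] Ck_on_scaleR[OF assms(1)]) auto
qed

lemma smooth_on_cong: "open S \<Longrightarrow> (\<And>y. y \<in> S \<Longrightarrow> f y = g y) \<Longrightarrow> smooth_on S f \<Longrightarrow> smooth_on S g"
  unfolding smooth_on_def using Ck_on_cong by blast

lemma smooth_on_subset: "smooth_on S f \<Longrightarrow> T \<subseteq> S \<Longrightarrow> smooth_on T f"
  unfolding smooth_on_def using Ck_on_subset by blast

lemma smooth_on_differentiable: "open S \<Longrightarrow> smooth_on S f \<Longrightarrow> x \<in> S \<Longrightarrow> f differentiable (at x)"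
  unfolding smooth_on_def differentiable_def using Ck_on_Suc_has_derivative by blast

lemma smooth_on_derivative: "smooth_on S f \<Longrightarrow> smooth_on S (\<lambda>x. frechet_derivative f (at x) v)"
  unfolding smooth_on_def by (metis Ck_on.simps(2))

lemma smooth_on_const: "smooth_on S (\<lambda>x. c)"
  by (simp add: smooth_on_def Ck_on_const)

lemma smooth_on_add: "open S \<Longrightarrow> smooth_on S f \<Longrightarrow> smooth_on S g \<Longrightarrow> smooth_on S (\<lambda>x. f x + g x)"
  by (simp add: smooth_on_def Ck_on_add)

lemma smooth_on_scaleR:
  fixes f :: "'a::real_normed_vector \<Rightarrow> real"
  shows "open S \<Longrightarrow> smooth_on S f \<Longrightarrow> smooth_on S g \<Longrightarrow> smooth_on S (\<lambda>x. f x *\<^sub>R g x)"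
  by (simp add: smooth_on_def Ck_on_scaleR)

lemma smooth_on_compose:
  fixes g :: "'a::real_normed_vector \<Rightarrow> 'b::euclidean_space"
  shows "open S \<Longrightarrow> open T \<Longrightarrow> g ` S \<subseteq> T \<Longrightarrow> smooth_on S g \<Longrightarrow> smooth_on T f \<Longrightarrow> smooth_on S (f \<circ> g)"
  by (simp add: smooth_on_def Ck_on_compose)

section \<open>The trace of a skew endomorphism\<close>

lemma trace_swap:
  fixes P Q :: "'e::euclidean_space \<Rightarrow> 'e"
  assumes "linear P" "linear Q"
  shows "(\<Sum>b\<in>Basis. P (Q b) \<bullet> b) = (\<Sum>b\<in>Basis. Q (P b) \<bullet> b)"
proof -
  have *: "(\<Sum>b\<in>Basis. P (Q b) \<bullet> b) = (\<Sum>b\<in>Basis. \<Sum>c\<in>Basis. (Q b \<bullet> c) * (P c \<bullet> b))"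
    if "linear P" for P Q :: "'e \<Rightarrow> 'e"
  proof (rule sum.cong[OF refl])
    fix b :: 'e
    show "P (Q b) \<bullet> b = (\<Sum>c\<in>Basis. (Q b \<bullet> c) * (P c \<bullet> b))"
      by (subst linear_Basis_expansion[OF that]) (simp add: inner_sum_left)
  qed
  show ?thesis
    by (subst *[OF assms(1)], subst *[OF assms(2)], subst sum.swap) (simp add: mult.commute)
qed

lemma trace_rank_one:
  fixes w :: "'e::euclidean_space" and \<alpha> :: "'e \<Rightarrow> real"
  assumes "linear \<alpha>"
  shows "(\<Sum>b\<in>Basis. (\<alpha> b *\<^sub>R w) \<bullet> b) = \<alpha> w"
  using linear_Basis_expansion[OF assms, of w] by (simp add: mult.commute)

lemma gram_isomorphism:
  fixes h :: "'e::euclidean_space \<Rightarrow> 'e \<Rightarrow> real"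
  assumes h: "bilinear h" "\<And>v. v \<noteq> 0 \<Longrightarrow> h v v > 0"
  shows "\<exists>G K. linear G \<and> linear K \<and> (\<forall>u v. G u \<bullet> v = h u v) \<and> (\<forall>x. K (G x) = x) \<and> (\<forall>x. G (K x) = x)"
proof -
  define G where "G u = (\<Sum>b\<in>Basis. h u b *\<^sub>R b)" for u :: 'e
  have G: "G u \<bullet> v = h u v" for u v
    using linear_Basis_expansion[of "h u" v] h(1)
    by (simp add: G_def inner_sum_left inner_commute[of v] mult.commute bilinear_def)
  have linG: "linear G"
    unfolding G_def using h(1)
    by (intro linearI)
      (simp_all add: bilinear_ladd bilinear_lmul scaleR_left_distrib sum.distrib scaleR_sum_right)
  have "inj G"
    using linG h(2) G by (subst linear_injective_0) (metis inner_zero_left less_irrefl)+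
  then obtain K where "linear K" "\<forall>x. K (G x) = x" "\<forall>x. G (K x) = x"
    using linear_injective_isomorphism[OF linG] by blast
  with linG G show ?thesis by blast
qed

text \<open>The Riesz representation for an arbitrary inner product, needed for the existence of gradients.\<close>

lemma linear_form_representation:
  fixes h :: "'e::euclidean_space \<Rightarrow> 'e \<Rightarrow> real"
  assumes "bilinear h" "\<And>v. v \<noteq> 0 \<Longrightarrow> h v v > 0" "linear \<alpha>"
  shows "\<exists>w. \<forall>v. h w v = \<alpha> v"
proof -
  obtain G K where G: "\<And>u v. G u \<bullet> v = h u v" and GK: "\<And>x. G (K x) = x"
    using gram_isomorphism[OF assms(1,2)] by metis
  have "h (K (\<Sum>b\<in>Basis. \<alpha> b *\<^sub>R b)) v = \<alpha> v" for v
    using linear_Basis_expansion[OF assms(3), of v]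
    by (simp add: G[symmetric] GK inner_sum_left inner_commute[of v] mult.commute)
  then show ?thesis by blast
qed

text \<open>In matrices: if \<open>G\<close> is the Gram matrix of \<open>h\<close> and \<open>N = G M\<close>, then \<open>N\<close> is skew-symmetric and
  \<open>tr M = tr (G\<^sup>-\<^sup>1 N) = tr ((G\<^sup>-\<^sup>1 N)\<^sup>T) = - tr (N G\<^sup>-\<^sup>1) = - tr M\<close>.\<close>

lemma trace_skew:
  fixes M :: "'e::euclidean_space \<Rightarrow> 'e"
  assumes M: "linear M" and h: "bilinear h" "\<And>u v. h u v = h v u" "\<And>v. v \<noteq> 0 \<Longrightarrow> h v v > (0::real)"
    and skew: "\<And>v. h (M v) v = 0"
  shows "(\<Sum>b\<in>Basis. M b \<bullet> b) = 0"
proof -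
  obtain G K where G: "linear G" "\<And>u v. G u \<bullet> v = h u v"
    and K: "linear K" "\<And>x. K (G x) = x" "\<And>x. G (K x) = x"
    using gram_isomorphism[OF h(1,3)] by metis
  have K_sym: "K u \<bullet> v = u \<bullet> K v" for u v
    using G(2)[of "K u" "K v"] G(2)[of "K v" "K u"] K(3) h(2) by (simp add: inner_commute)
  have pol: "h (M u) v = - h (M v) u" for u v
    using skew[of "u + v"] skew[of u] skew[of v] by (simp add: linear_add[OF M] bilinear_ladd[OF h(1)] bilinear_radd[OF h(1)])
  have N_skew: "G (M u) \<bullet> v = - (u \<bullet> G (M v))" for u v
    using pol[of u v] by (simp add: G inner_commute[of u])
  have "(\<Sum>b\<in>Basis. M b \<bullet> b) = (\<Sum>b\<in>Basis. K (G (M b)) \<bullet> b)"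
    by (simp add: K)
  also have "\<dots> = (\<Sum>b\<in>Basis. - (G (M (K b)) \<bullet> b))"
  proof (intro sum.cong refl)
    fix b
    show "K (G (M b)) \<bullet> b = - (G (M (K b)) \<bullet> b)"
      using K_sym[of "G (M b)" b] N_skew[of b "K b"] by (simp only: inner_commute)
  qed
  also have "\<dots> = - (\<Sum>b\<in>Basis. K (G (M b)) \<bullet> b)"
    using trace_swap[OF K(1) linear_compose[OF M G(1)]] by (simp add: sum_negf)
  finally show ?thesis by (simp add: K)
qed

section \<open>Local vector fields and local functions\<close>

locale atlas =
  fixes A :: "('m::{t2_space, second_countable_topology}, 'e::euclidean_space) chart set"
  assumes smooth_atlas: "smooth_atlas A"
begin

lemma open_dom_chart: "c \<in> A \<Longrightarrow> open (dom_chart c)"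
  using smooth_atlas by (auto simp: smooth_atlas_def)

lemma inv_chart_map [simp]: "c \<in> A \<Longrightarrow> p \<in> dom_chart c \<Longrightarrow> inv_chart c (map_chart c p) = p"
  using smooth_atlas unfolding smooth_atlas_def homeomorphism_def by blast

lemma map_inv_chart [simp]:
  "c \<in> A \<Longrightarrow> x \<in> map_chart c ` dom_chart c \<Longrightarrow> map_chart c (inv_chart c x) = x"
  by auto

lemma open_map_chart:
  assumes "c \<in> A" "open U"
  shows "open (map_chart c ` (U \<inter> dom_chart c))"
proof -
  have "homeomorphism (dom_chart c) (map_chart c ` dom_chart c) (map_chart c) (inv_chart c)"
    and "open (map_chart c ` dom_chart c)"
    using smooth_atlas assms(1) by (auto simp: smooth_atlas_def)
  then show ?thesis
    using homeomorphism_imp_open_map[of "dom_chart c" "map_chart c ` dom_chart c" _ _ "U \<inter> dom_chart c"]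
      assms openin_open_trans[of "map_chart c ` dom_chart c"] open_dom_chart
    by (metis inf_le2 open_Int open_openin_trans openin_open_trans)
qed

lemma smooth_transition:
  "c \<in> A \<Longrightarrow> c' \<in> A \<Longrightarrow>
     smooth_on (map_chart c ` (dom_chart c \<inter> dom_chart c')) (map_chart c' \<circ> inv_chart c)"
  using smooth_atlas by (auto simp: smooth_atlas_def)

lemma chart_at: "chart_at A p \<in> A" "p \<in> dom_chart (chart_at A p)"
proof -
  have "\<exists>c. c \<in> A \<and> p \<in> dom_chart c"
    using smooth_atlas UNIV_I[of p] unfolding smooth_atlas_def by blast
  from someI_ex[OF this] show "chart_at A p \<in> A" "p \<in> dom_chart (chart_at A p)"
    by (simp_all add: chart_at_def)
qed

lemma open_overlap: "c \<in> A \<Longrightarrow> c' \<in> A \<Longrightarrow> open (map_chart c ` (dom_chart c \<inter> dom_chart c'))"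
  using open_map_chart[OF _ open_dom_chart[of c']] by (simp add: Int_commute)

lemma transition_has_derivative:
  assumes "c \<in> A" "c' \<in> A" "p \<in> dom_chart c" "p \<in> dom_chart c'"
  shows "((map_chart c' \<circ> inv_chart c) has_derivative
    frechet_derivative (map_chart c' \<circ> inv_chart c) (at (map_chart c p))) (at (map_chart c p))"
  using smooth_on_differentiable[OF open_overlap smooth_transition, of c c' "map_chart c p"] assms
  by (simp add: frechet_derivative_works[symmetric])

lemma linear_components:
  assumes "c \<in> A" "p \<in> dom_chart c"
  shows "linear (components A c p)"
  using has_derivative_linear[OF transition_has_derivative[OF chart_at(1) assms(1) chart_at(2) assms(2)]]
  by (simp add: components_def[abs_def])

lemma vector_field_on_subset:
  assumes "vector_field_on A U X" "open W" "W \<subseteq> U"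
  shows "vector_field_on A W X"
  unfolding vector_field_on_def
proof (intro conjI ballI assms(2))
  fix c assume "c \<in> A"
  moreover have "map_chart c ` (W \<inter> dom_chart c) \<subseteq> map_chart c ` (U \<inter> dom_chart c)"
    using assms(3) by auto
  ultimately show "smooth_on (map_chart c ` (W \<inter> dom_chart c)) (vf_rep A c X)"
    using assms(1) by (auto simp: vector_field_on_def intro: smooth_on_subset)
qed

lemma vector_field_on_open: "vector_field_on A U X \<Longrightarrow> open U"
  by (simp add: vector_field_on_def)

lemma smooth_fun_on_const: "open U \<Longrightarrow> smooth_fun_on A U (\<lambda>q. r)"
  by (simp add: smooth_fun_on_def o_def smooth_on_const)

lemma vector_field_on_zero: "open U \<Longrightarrow> vector_field_on A U (\<lambda>q. 0)"
  unfolding vector_field_on_def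
proof (intro conjI ballI)
  fix c assume U: "open U" and c: "c \<in> A"
  show "smooth_on (map_chart c ` (U \<inter> dom_chart c)) (vf_rep A c (\<lambda>q. 0))"
    by (rule smooth_on_cong[OF open_map_chart[OF c U] _ smooth_on_const[of _ 0]])
      (auto simp: vf_rep_def c linear_0[OF linear_components[OF c]])
qed

lemma vector_field_on_add:
  assumes "vector_field_on A U X" "vector_field_on A U Y"
  shows "vector_field_on A U (\<lambda>q. X q + Y q)"
  unfolding vector_field_on_def
proof (intro conjI ballI)
  show U: "open U" using assms(1) by (simp add: vector_field_on_def)
  fix c assume c: "c \<in> A"
  have "smooth_on (map_chart c ` (U \<inter> dom_chart c)) (\<lambda>x. vf_rep A c X x + vf_rep A c Y x)"
    using assms c by (intro smooth_on_add open_map_chart U) (auto simp: vector_field_on_def)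
  then show "smooth_on (map_chart c ` (U \<inter> dom_chart c)) (vf_rep A c (\<lambda>q. X q + Y q))"
    by (rule smooth_on_cong[OF open_map_chart[OF c U], rotated])
      (auto simp: vf_rep_def c linear_add[OF linear_components[OF c]])
qed

lemma vector_field_on_scaleR:
  assumes "smooth_fun_on A U k" "vector_field_on A U X"
  shows "vector_field_on A U (\<lambda>q. k q *\<^sub>R X q)"
  unfolding vector_field_on_def
proof (intro conjI ballI)
  show U: "open U" using assms(2) by (simp add: vector_field_on_def)
  fix c assume c: "c \<in> A"
  have "smooth_on (map_chart c ` (U \<inter> dom_chart c)) (\<lambda>x. (k \<circ> inv_chart c) x *\<^sub>R vf_rep A c X x)"
    using assms c by (intro smooth_on_scaleR open_map_chart U) (simp_all add: vector_field_on_def smooth_fun_on_def del: o_apply)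
  then show "smooth_on (map_chart c ` (U \<inter> dom_chart c)) (vf_rep A c (\<lambda>q. k q *\<^sub>R X q))"
    by (rule smooth_on_cong[OF open_map_chart[OF c U], rotated])
      (auto simp: vf_rep_def c linear_scale[OF linear_components[OF c]])
qed

lemma smooth_fun_on_mult:
  assumes "smooth_fun_on A U k" "smooth_fun_on A U l"
  shows "smooth_fun_on A U (\<lambda>q. k q * l q)"
  unfolding smooth_fun_on_def
proof (intro conjI ballI)
  show U: "open U" using assms(1) by (simp add: smooth_fun_on_def)
  fix c assume c: "c \<in> A"
  then show "smooth_on (map_chart c ` (U \<inter> dom_chart c)) ((\<lambda>q. k q * l q) \<circ> inv_chart c)"
    using smooth_on_scaleR[OF open_map_chart[OF c U], of "k \<circ> inv_chart c" "l \<circ> inv_chart c"] assms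
    by (auto simp: smooth_fun_on_def o_def)
qed

text \<open>Every tangent vector extends to a smooth vector field near its base point: the field with
  constant components in the chart which represents the tangent space there.\<close>

lemma local_vector_field:
  obtains U X where "vector_field_on A U X" "p \<in> U" "X p = v"
proof -
  define c0 where "c0 = chart_at A p"
  define T where "T c c' q = frechet_derivative (map_chart c' \<circ> inv_chart c) (at (map_chart c q))"
    for c c' :: "('m, 'e) chart" and q
  define X where "X q = T c0 (chart_at A q) q v" for q
  have c0: "c0 \<in> A" "p \<in> dom_chart c0" using chart_at[of p] by (simp_all add: c0_def)
  \<comment> \<open>The chart that represents the tangent space at \<open>q\<close> varies with \<open>q\<close> arbitrarily; the chain rule
    eliminates it from the components of \<open>X\<close>.\<close>
  have cocycle: "T c' c'' q (T c c' q w) = T c c'' q w"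
    if cs: "c \<in> A" "c' \<in> A" "c'' \<in> A" and q: "q \<in> dom_chart c" "q \<in> dom_chart c'" "q \<in> dom_chart c''"
    for c c' c'' q w
  proof -
    let ?x = "map_chart c q"
    have x: "(map_chart c' \<circ> inv_chart c) ?x = map_chart c' q" using cs q by simp
    have "((map_chart c'' \<circ> inv_chart c') \<circ> (map_chart c' \<circ> inv_chart c) has_derivative
        T c' c'' q \<circ> T c c' q) (at ?x)"
      unfolding T_def using cs q
      by (intro diff_chain_at) (simp_all only: x transition_has_derivative)
    moreover have "frechet_derivative ((map_chart c'' \<circ> inv_chart c') \<circ> (map_chart c' \<circ> inv_chart c)) (at ?x)
        = T c c'' q"
      unfolding T_def
      by (rule frechet_derivative_cong_open[OF open_overlap[OF cs(1,2)]]) (use cs q in auto)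
    ultimately have "T c c'' q = T c' c'' q \<circ> T c c' q"
      by (metis frechet_derivative_at)
    then show ?thesis by simp
  qed
  have rep: "vf_rep A c X (map_chart c q) = T c0 c q v" if "c \<in> A" "q \<in> dom_chart c0 \<inter> dom_chart c" for c q
    using that cocycle[of c0 "chart_at A q" c q v] chart_at[of q] c0(1)
    by (simp add: vf_rep_def components_def X_def T_def[symmetric])
  have "vector_field_on A (dom_chart c0) X"
    unfolding vector_field_on_def
  proof (intro conjI ballI)
    show U: "open (dom_chart c0)" using c0 open_dom_chart by simp
    fix c assume c: "c \<in> A"
    let ?S = "map_chart c ` (dom_chart c0 \<inter> dom_chart c)"
    let ?D = "\<lambda>y. frechet_derivative (map_chart c \<circ> inv_chart c0) (at y) v"
    have "smooth_on ?S (?D \<circ> (map_chart c0 \<circ> inv_chart c))"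
    proof (rule smooth_on_compose)
      show "open ?S" by (rule open_map_chart[OF c U])
      show "open (map_chart c0 ` (dom_chart c0 \<inter> dom_chart c))" by (rule open_overlap[OF c0(1) c])
      show "(map_chart c0 \<circ> inv_chart c) ` ?S \<subseteq> map_chart c0 ` (dom_chart c0 \<inter> dom_chart c)"
        using c by auto
      show "smooth_on ?S (map_chart c0 \<circ> inv_chart c)"
        using smooth_transition[OF c c0(1)] by (simp add: Int_commute)
      show "smooth_on (map_chart c0 ` (dom_chart c0 \<inter> dom_chart c)) ?D"
        by (rule smooth_on_derivative[OF smooth_transition[OF c0(1) c]])
    qed
    then show "smooth_on ?S (vf_rep A c X)"
      by (rule smooth_on_cong[OF open_map_chart[OF c U], rotated]) (auto simp: rep[OF c] T_def[symmetric] c c0)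
  qed
  moreover have "X p = v"
  proof -
    have "frechet_derivative (map_chart c0 \<circ> inv_chart c0) (at (map_chart c0 p))
        = frechet_derivative (\<lambda>x. x) (at (map_chart c0 p))"
      by (rule frechet_derivative_cong_open[OF open_overlap[OF c0(1) c0(1)]]) (use c0 in auto)
    then show ?thesis by (simp add: X_def T_def c0_def[symmetric])
  qed
  ultimately show thesis using that c0(2) by blast
qed

subsection \<open>The differential of a function\<close>

lemma local_representation_has_derivative:
  assumes "smooth_fun_on A U k" "p \<in> U"
  shows "(k \<circ> inv_chart (chart_at A p) has_derivative differential A k p) (at (map_chart (chart_at A p) p))"
proof -
  let ?c = "chart_at A p"
  have "open U" "smooth_on (map_chart ?c ` (U \<inter> dom_chart ?c)) (k \<circ> inv_chart ?c)"
    using assms chart_at[of p] by (auto simp: smooth_fun_on_def)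
  from smooth_on_differentiable[OF open_map_chart[OF chart_at(1) this(1)] this(2)]
  show ?thesis
    using assms(2) chart_at[of p]
    by (simp add: differential_def[abs_def] frechet_derivative_works[symmetric])
qed

lemma linear_differential: "smooth_fun_on A U k \<Longrightarrow> p \<in> U \<Longrightarrow> linear (differential A k p)"
  using has_derivative_linear local_representation_has_derivative by blast

lemma differential_eqI:
  assumes "(k \<circ> inv_chart (chart_at A p) has_derivative F) (at (map_chart (chart_at A p) p))"
  shows "differential A k p = F"
  using frechet_derivative_at[OF assms] by (simp add: differential_def[abs_def])

lemma differential_const [simp]: "differential A (\<lambda>q. r) p v = 0"
  by (simp add: differential_def o_def)

lemma differential_add:
  assumes "smooth_fun_on A U k" "smooth_fun_on A U l" "p \<in> U"
  shows "differential A (\<lambda>q. k q + l q) p v = differential A k p v + differential A l p v"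
proof -
  have "differential A (\<lambda>q. k q + l q) p = (\<lambda>v. differential A k p v + differential A l p v)"
    using has_derivative_add[OF assms(1,2)[THEN local_representation_has_derivative, OF assms(3)]]
    by (intro differential_eqI) (simp add: o_def)
  then show ?thesis by simp
qed

lemma differential_mult:
  assumes "smooth_fun_on A U k" "smooth_fun_on A U l" "p \<in> U"
  shows "differential A (\<lambda>q. k q * l q) p v = k p * differential A l p v + differential A k p v * l p"
proof -
  have "differential A (\<lambda>q. k q * l q) p = (\<lambda>v. k p * differential A l p v + differential A k p v * l p)"
    using has_derivative_mult[OF assms(1,2)[THEN local_representation_has_derivative, OF assms(3)]]
      chart_at[of p]
    by (intro differential_eqI) (simp add: o_def)
  then show ?thesis by simp
qed

lemma differential_cmult:
  assumes "smooth_fun_on A U k" "p \<in> U"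
  shows "differential A (\<lambda>q. r * k q) p v = r * differential A k p v"
  using differential_mult[OF smooth_fun_on_const[of U r] assms] assms(1)
  by (simp add: smooth_fun_on_def)

subsection \<open>Affine connections\<close>

lemma connection_linear:
  assumes "affine_connection A D" "vector_field_on A U Y" "p \<in> U"
  shows "linear (D Y p)"
  using assms(1)[unfolded affine_connection_def, THEN conjunct1, rule_format, OF assms(2,3)] .

lemma connection_add:
  assumes "affine_connection A D" "vector_field_on A U Y" "vector_field_on A U Z" "p \<in> U"
  shows "D (\<lambda>q. Y q + Z q) p v = D Y p v + D Z p v"
  using assms(1)[unfolded affine_connection_def, THEN conjunct2, THEN conjunct1, rule_format,
      OF conjI[OF assms(2,3)] assms(4)] .

lemma connection_scaleR:
  assumes "affine_connection A D" "smooth_fun_on A U k" "vector_field_on A U Y" "p \<in> U"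
  shows "D (\<lambda>q. k q *\<^sub>R Y q) p v = differential A k p v *\<^sub>R Y p + k p *\<^sub>R D Y p v"
  using assms(1)[unfolded affine_connection_def, THEN conjunct2, THEN conjunct2, THEN conjunct1,
      rule_format, OF conjI[OF assms(2,3)] assms(4)] .

lemma connection_zero:
  assumes "affine_connection A D"
  shows "D (\<lambda>q. 0) p v = 0"
proof -
  have "D (\<lambda>q. 0 + 0) p v = D (\<lambda>q. 0) p v + D (\<lambda>q. 0) p v"
    using connection_add[OF assms vector_field_on_zero vector_field_on_zero] open_UNIV by blast
  then show ?thesis by simp
qed

end

section \<open>The Levi-Civita connection\<close>

locale levi_civita_manifold = atlas A
  for A :: "('m::{t2_space, second_countable_topology}, 'e::euclidean_space) chart set" +
  fixes g :: "'m \<Rightarrow> 'e \<Rightarrow> 'e \<Rightarrow> real" and D :: "('m, 'e) connection"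
  assumes metric: "riemannian_metric A g" and levi_civita: "levi_civita A g D"
begin

lemma bilinear_g: "bilinear (g p)"
  and g_sym: "g p u v = g p v u"
  and g_pos: "v \<noteq> 0 \<Longrightarrow> g p v v > 0"
  using metric by (simp_all add: riemannian_metric_def)

lemmas g_linear = bilinear_ladd[OF bilinear_g] bilinear_radd[OF bilinear_g]
  bilinear_lmul[OF bilinear_g] bilinear_rmul[OF bilinear_g]
  bilinear_lsub[OF bilinear_g] bilinear_rsub[OF bilinear_g]
  bilinear_lneg[OF bilinear_g] bilinear_rneg[OF bilinear_g]
  bilinear_lzero[OF bilinear_g] bilinear_rzero[OF bilinear_g]

lemma g_nondegenerate:
  assumes "\<And>v. g p u v = g p w v"
  shows "u = w"
  using assms[of "u - w"] g_pos[of "u - w" p] by (force simp: g_linear)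

lemma smooth_fun_on_g:
  assumes "vector_field_on A U X" "vector_field_on A U Y"
  shows "smooth_fun_on A U (\<lambda>q. g q (X q) (Y q))"
  using metric[unfolded riemannian_metric_def, THEN conjunct2, THEN conjunct2, THEN conjunct2,
      rule_format, OF conjI[OF assms]] .

lemma affine: "affine_connection A D"
  using levi_civita by (simp add: levi_civita_def)

lemmas D_linear = connection_linear[OF affine]

lemma lie_bracket_eq:
  assumes "vector_field_on A U X" "vector_field_on A U Y" "p \<in> U"
  shows "lie_bracket A X Y p = D Y p (X p) - D X p (Y p)"
  using levi_civita[unfolded levi_civita_def, THEN conjunct2, THEN conjunct1, rule_format,
      OF conjI[OF assms(1,2)] assms(3)] by (simp add: cov_def)

lemma differential_g:
  assumes Y: "vector_field_on A U Y" and Z: "vector_field_on A U Z" and p: "p \<in> U"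
  shows "differential A (\<lambda>q. g q (Y q) (Z q)) p v = g p (D Y p v) (Z p) + g p (Y p) (D Z p v)"
proof -
  obtain W X where X: "vector_field_on A W X" "p \<in> W" "X p = v"
    by (rule local_vector_field)
  have UW: "open (U \<inter> W)" using X Y by (simp add: vector_field_on_def open_Int)
  have "vector_field_on A (U \<inter> W) X" "vector_field_on A (U \<inter> W) Y" "vector_field_on A (U \<inter> W) Z"
    using X(1) Y Z UW by (blast intro: vector_field_on_subset)+
  then have "differential A (\<lambda>q. g q (Y q) (Z q)) p (X p) =
      g p (cov D X Y p) (Z p) + g p (Y p) (cov D X Z p)"
    by (intro levi_civita[unfolded levi_civita_def, THEN conjunct2, THEN conjunct2, rule_format,
          of "U \<inter> W"] conjI) (use p X(2) in auto)
  then show ?thesis by (simp add: cov_def X(3))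
qed

lemma g_grad:
  assumes "smooth_fun A f"
  shows "g p (grad A g f p) v = differential A f p v"
proof -
  obtain w where w: "\<forall>v. g p w v = differential A f p v"
    using linear_form_representation[OF bilinear_g g_pos linear_differential[OF assms UNIV_I]] by blast
  then have "grad A g f p = w"
    unfolding grad_def by (intro the_equality g_nondegenerate[of p]) simp_all
  then show ?thesis using w by simp
qed

lemma grad_eqI:
  assumes "smooth_fun A f" "\<And>v. g p w v = differential A f p v"
  shows "grad A g f p = w"
  using g_nondegenerate[of p "grad A g f p" w] g_grad[OF assms(1)] assms(2) by simp

lemma lie_derivative_g:
  assumes V: "vector_field_on A U V" and X: "vector_field_on A U X" and Y: "vector_field_on A U Y"
    and p: "p \<in> U"
  shows "lie_derivative A V g X Y p = g p (D V p (X p)) (Y p) + g p (X p) (D V p (Y p))"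
  unfolding lie_derivative_def as_tensor_def differential_g[OF X Y p]
    lie_bracket_eq[OF V X p] lie_bracket_eq[OF V Y p]
  by (simp add: g_linear)

end

section \<open>Kenmotsu manifolds\<close>

locale kenmotsu_manifold = levi_civita_manifold A g D
  for A :: "('m::{t2_space, second_countable_topology}, 'e::euclidean_space) chart set"
    and g :: "'m \<Rightarrow> 'e \<Rightarrow> 'e \<Rightarrow> real" and D :: "('m, 'e) connection" +
  fixes \<phi> :: "'m \<Rightarrow> 'e \<Rightarrow> 'e" and \<xi> :: "'m \<Rightarrow> 'e" and \<eta> :: "'m \<Rightarrow> 'e \<Rightarrow> real"
  assumes kenmotsu: "kenmotsu A \<phi> \<xi> \<eta> g D"
begin

lemma almost_contact: "almost_contact_metric A \<phi> \<xi> \<eta> g"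
  using kenmotsu by (simp add: kenmotsu_def)

lemma vector_field_\<xi>: "vector_field A \<xi>"
  and one_form_\<eta>: "one_form A \<eta>"
  and endomorphism_\<phi>: "endomorphism_field A \<phi>"
  and \<phi>_\<phi>: "\<phi> p (\<phi> p v) = - v + \<eta> p v *\<^sub>R \<xi> p"
  and \<eta>_\<xi> [simp]: "\<eta> p (\<xi> p) = 1"
  and g_\<phi>: "g p (\<phi> p u) (\<phi> p v) = g p u v - \<eta> p u * \<eta> p v"
  using almost_contact unfolding almost_contact_metric_def by blast+

lemma g_\<xi> [simp]: "g p (\<xi> p) v = \<eta> p v"
  using almost_contact unfolding almost_contact_metric_def by metis

lemma g_\<xi>' [simp]: "g p v (\<xi> p) = \<eta> p v"
  by (subst g_sym) simp

lemma vector_field_on_\<xi>: "open U \<Longrightarrow> vector_field_on A U \<xi>"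
  using vector_field_on_subset[OF vector_field_\<xi>] by simp

lemma \<eta>_linear: "linear (\<eta> p)" and \<phi>_linear: "linear (\<phi> p)"
  using one_form_\<eta> endomorphism_\<phi> by (simp_all add: one_form_def endomorphism_field_def)

lemmas \<eta>_simps = linear_add[OF \<eta>_linear] linear_diff[OF \<eta>_linear] linear_scale[OF \<eta>_linear]
  linear_neg[OF \<eta>_linear] linear_0[OF \<eta>_linear]

lemma smooth_fun_on_\<eta>:
  assumes "vector_field_on A U X"
  shows "smooth_fun_on A U (\<lambda>q. \<eta> q (X q))"
  using one_form_\<eta>[unfolded one_form_def, THEN conjunct2, rule_format, OF assms] .

lemma \<xi>_nonzero: "\<xi> p \<noteq> 0"
  using \<eta>_\<xi>[of p] \<eta>_simps(5)[of p] by force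

lemma \<phi>_\<xi> [simp]: "\<phi> p (\<xi> p) = 0"
  using g_\<phi>[of p "\<xi> p" "\<xi> p"] g_pos[of "\<phi> p (\<xi> p)" p] by force

lemma \<eta>_\<phi> [simp]: "\<eta> p (\<phi> p v) = 0"
proof -
  have "\<phi> p (\<phi> p (\<phi> p v)) = - \<phi> p v"
    by (simp add: \<phi>_\<phi> linear_diff[OF \<phi>_linear] linear_scale[OF \<phi>_linear])
  then show ?thesis
    using \<phi>_\<phi>[of p "\<phi> p v"] \<xi>_nonzero[of p] by simp
qed

text \<open>Applied to \<open>\<xi>\<close>, the Kenmotsu identity reads \<open>\<phi> (\<nabla>\<^sub>v \<xi>) = \<phi> v\<close>, which determines
  \<open>\<nabla>\<^sub>v \<xi>\<close> up to a multiple of \<open>\<xi>\<close>; and \<open>\<nabla>\<^sub>v \<xi>\<close> is orthogonal to \<open>\<xi>\<close> since \<open>\<xi>\<close> has constant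
  length.\<close>

lemma D_\<xi>: "D \<xi> p v = v - \<eta> p v *\<^sub>R \<xi> p"
proof -
  obtain U X where X: "vector_field_on A U X" "p \<in> U" "X p = v"
    by (rule local_vector_field)
  have "vector_field_on A U \<xi>"
    using X vector_field_on_\<xi> vector_field_on_open by blast
  then have "cov_endo D X \<phi> \<xi> p = g p (\<phi> p (X p)) (\<xi> p) *\<^sub>R \<xi> p - \<eta> p (\<xi> p) *\<^sub>R \<phi> p (X p)"
    using kenmotsu[unfolded kenmotsu_def, THEN conjunct2, THEN conjunct2, rule_format, OF conjI] X
    by blast
  then have "\<phi> p (D \<xi> p v) = \<phi> p v"
    by (simp add: cov_endo_def cov_def X(3) connection_zero[OF affine])
  then have "- D \<xi> p v + \<eta> p (D \<xi> p v) *\<^sub>R \<xi> p = - v + \<eta> p v *\<^sub>R \<xi> p"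
    using \<phi>_\<phi>[of p] by metis
  moreover have "\<eta> p (D \<xi> p v) = 0"
    using differential_g[OF vector_field_\<xi> vector_field_\<xi> UNIV_I, of p v] by simp
  ultimately show ?thesis
    by (simp add: algebra_simps)
qed

lemma differential_\<eta>:
  assumes X: "vector_field_on A U X" and p: "p \<in> U"
  shows "differential A (\<lambda>q. \<eta> q (X q)) p v = g p v (X p) - \<eta> p v * \<eta> p (X p) + \<eta> p (D X p v)"
  using differential_g[OF vector_field_on_\<xi>[OF vector_field_on_open[OF X]] X p, of v]
  by (simp add: D_\<xi> g_linear)

text \<open>The hypothesis determines \<open>L\<close> only through the quadratic form \<open>g(L v, v)\<close> on horizontal vectors.
  Subtracting from \<open>L\<close> the endomorphism \<open>\<mu> (v - \<eta>(v) \<xi>)\<close> and the rank one terms that account for the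
  values of \<open>g(L v, w)\<close> with \<open>v\<close> or \<open>w\<close> along \<open>\<xi>\<close> leaves an endomorphism \<open>M\<close> whose whole quadratic form
  vanishes; it is skew, hence trace free.\<close>

lemma trace_of_horizontally_scalar:
  assumes L: "linear L" and \<mu>: "\<And>v. \<eta> p v = 0 \<Longrightarrow> g p (L v) v = \<mu> * g p v v"
  shows "(\<Sum>b\<in>Basis. L b \<bullet> b) = (real DIM('e) - 1) * \<mu> + g p (L (\<xi> p)) (\<xi> p)"
proof -
  define H where "H = g p (L (\<xi> p)) (\<xi> p)"
  define M where "M v = L v - \<mu> *\<^sub>R v + (\<eta> p v) *\<^sub>R ((\<mu> + H) *\<^sub>R \<xi> p - L (\<xi> p)) - g p (L v) (\<xi> p) *\<^sub>R \<xi> p" for v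
  have "linear M"
    unfolding M_def using linear_add[OF L] linear_scale[OF L]
    by (intro linearI) (simp_all add: \<eta>_simps g_linear algebra_simps)
  moreover have "g p (M v) v = 0" for v
  proof -
    define s where "s = \<eta> p v"
    have "\<eta> p (v - s *\<^sub>R \<xi> p) = 0" by (simp add: \<eta>_simps s_def)
    from \<mu>[OF this] show ?thesis
      unfolding M_def
      by (simp add: linear_diff[OF L] linear_scale[OF L] g_linear \<eta>_simps H_def s_def[symmetric] algebra_simps)
  qed
  ultimately have "(\<Sum>b\<in>Basis. M b \<bullet> b) = 0"
    by (intro trace_skew[of M "g p"] bilinear_g g_sym g_pos)
  moreover have "linear (\<lambda>v. \<eta> p (L v))"
    using linear_compose[OF L \<eta>_linear] by (simp add: o_def)
  then have "(\<Sum>b\<in>Basis. (\<eta> p (L b) *\<^sub>R \<xi> p) \<bullet> b) = H"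
    using trace_rank_one by (simp add: H_def)
  moreover have "(\<Sum>b\<in>Basis. (\<eta> p b *\<^sub>R ((\<mu> + H) *\<^sub>R \<xi> p - L (\<xi> p))) \<bullet> b) = \<mu>"
    by (subst trace_rank_one[OF \<eta>_linear]) (simp add: \<eta>_simps H_def)
  moreover have "(\<Sum>b\<in>Basis. M b \<bullet> b) = (\<Sum>b\<in>Basis. L b \<bullet> b) - \<mu> * real DIM('e)
      + (\<Sum>b\<in>Basis. (\<eta> p b *\<^sub>R ((\<mu> + H) *\<^sub>R \<xi> p - L (\<xi> p))) \<bullet> b) - (\<Sum>b\<in>Basis. (\<eta> p (L b) *\<^sub>R \<xi> p) \<bullet> b)"
    by (simp add: M_def inner_add_left inner_diff_left sum.distrib sum_subtractf)
  ultimately show ?thesis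
    by (simp add: H_def algebra_simps)
qed

end

section \<open>The deformed metric\<close>

locale deformed_kenmotsu_manifold = kenmotsu_manifold A g D \<phi> \<xi> \<eta> + deformed: levi_civita_manifold A g' D'
  for A :: "('m::{t2_space, second_countable_topology}, 'e::euclidean_space) chart set"
    and g :: "'m \<Rightarrow> 'e \<Rightarrow> 'e \<Rightarrow> real" and D :: "('m, 'e) connection"
    and \<phi> :: "'m \<Rightarrow> 'e \<Rightarrow> 'e" and \<xi> :: "'m \<Rightarrow> 'e" and \<eta> :: "'m \<Rightarrow> 'e \<Rightarrow> real"
    and g' :: "'m \<Rightarrow> 'e \<Rightarrow> 'e \<Rightarrow> real" and D' :: "('m, 'e) connection" +
  fixes a :: real
  assumes a_pos: "a > 0"
    and g'_eq: "g' p u v = a * g p u v + a * (a - 1) * \<eta> p u * \<eta> p v"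
begin

lemma differential_g':
  assumes Y: "vector_field_on A U Y" and Z: "vector_field_on A U Z" and p: "p \<in> U"
  shows "differential A (\<lambda>q. g' q (Y q) (Z q)) p v =
    a * differential A (\<lambda>q. g q (Y q) (Z q)) p v
    + a * (a - 1) * (\<eta> p (Y p) * differential A (\<lambda>q. \<eta> q (Z q)) p v
      + differential A (\<lambda>q. \<eta> q (Y q)) p v * \<eta> p (Z p))"
proof -
  let ?gYZ = "\<lambda>q. g q (Y q) (Z q)" and ?\<eta>Y = "\<lambda>q. \<eta> q (Y q)" and ?\<eta>Z = "\<lambda>q. \<eta> q (Z q)"
  have U: "open U" by (rule vector_field_on_open[OF Y])
  note sm = smooth_fun_on_g[OF Y Z] smooth_fun_on_\<eta>[OF Y] smooth_fun_on_\<eta>[OF Z]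
  have "differential A (\<lambda>q. a * ?gYZ q + (a * (a - 1)) * (?\<eta>Y q * ?\<eta>Z q)) p v =
      a * differential A ?gYZ p v + a * (a - 1) * differential A (\<lambda>q. ?\<eta>Y q * ?\<eta>Z q) p v"
    using smooth_fun_on_mult[OF sm(2,3)] smooth_fun_on_mult[OF smooth_fun_on_const[OF U] sm(1)]
      smooth_fun_on_mult[OF smooth_fun_on_const[OF U] smooth_fun_on_mult[OF sm(2,3)]]
    by (simp only: differential_add[OF _ _ p] differential_cmult[OF _ p] sm(1))
  then show ?thesis
    by (simp add: g'_eq differential_mult[OF sm(2,3) p] mult.assoc)
qed

text \<open>With this correction term \<open>D\<close> becomes a torsion-free connection for which \<open>g'\<close> is parallel. The
  coefficient comes from \<open>(\<nabla>\<^sub>X \<eta>)(Y) = g(X,Y) - \<eta>(X) \<eta>(Y)\<close>, which enters the derivative of \<open>g'\<close> with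
  the factor \<open>a (a - 1)\<close>, and from \<open>g'(\<xi>,Z) = a\<^sup>2 \<eta>(Z)\<close>.
  As in the uniqueness of the Levi-Civita connection, the difference \<open>S\<close> to \<open>D'\<close> vanishes because
  \<open>g'(S(X,Y),Z)\<close> is symmetric in \<open>X, Y\<close> and skew in \<open>Y, Z\<close>.\<close>

lemma deformed_connection:
  assumes Y: "vector_field_on A U Y" and p: "p \<in> U"
  shows "D' Y p v = D Y p v + ((a - 1) / a * (g p v (Y p) - \<eta> p v * \<eta> p (Y p))) *\<^sub>R \<xi> p"
proof -
  define S where "S X Y = D' Y p (X p) - D Y p (X p)
    - ((a - 1) / a * (g p (X p) (Y p) - \<eta> p (X p) * \<eta> p (Y p))) *\<^sub>R \<xi> p" for X Y :: "'m \<Rightarrow> 'e"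
  have S_sym: "S X Y = S Y X"
    if "vector_field_on A W X" "vector_field_on A W Y" "p \<in> W" for X Y W
    using lie_bracket_eq[OF that] deformed.lie_bracket_eq[OF that]
    by (simp add: S_def g_sym[of p "X p"] mult.commute algebra_simps)
  have S_skew: "g' p (S X Y) (Z p) = - g' p (S X Z) (Y p)"
    if W: "vector_field_on A W X" "vector_field_on A W Y" "vector_field_on A W Z" "p \<in> W" for X Y Z W
  proof -
    have sum: "g' p (D' Y p (X p)) (Z p) + g' p (D' Z p (X p)) (Y p) =
        a * (g p (D Y p (X p)) (Z p) + g p (D Z p (X p)) (Y p))
        + a * (a - 1) * (\<eta> p (Y p) * (g p (X p) (Z p) - \<eta> p (X p) * \<eta> p (Z p) + \<eta> p (D Z p (X p)))
          + (g p (X p) (Y p) - \<eta> p (X p) * \<eta> p (Y p) + \<eta> p (D Y p (X p))) * \<eta> p (Z p))"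
      using differential_g'[OF W(2,3,4), of "X p"] deformed.differential_g[OF W(2,3,4), of "X p"]
      by (simp add: differential_g[OF W(2-4)] differential_\<eta>[OF W(2,4)] differential_\<eta>[OF W(3,4)]
          g_sym[of p _ "D Z p (X p)"] deformed.g_sym[of p _ "D' Z p (X p)"])
    have g'_S: "g' p (S X Y) (Z p) = g' p (D' Y p (X p)) (Z p) - a * g p (D Y p (X p)) (Z p)
        - a * (a - 1) * (\<eta> p (D Y p (X p)) + g p (X p) (Y p) - \<eta> p (X p) * \<eta> p (Y p)) * \<eta> p (Z p)" for Y Z
      using a_pos unfolding S_def deformed.g_linear
      by (simp add: g'_eq \<eta>_simps g_linear field_simps)
    show ?thesis
      unfolding g'_S using sum by (simp add: g_sym[of p "Y p"] algebra_simps)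
  qed
  obtain W X where X: "vector_field_on A W X" "p \<in> W" "X p = v"
    by (rule local_vector_field)
  have "g' p (S X Y) w = g' p 0 w" for w
  proof -
    obtain W' Z where Z: "vector_field_on A W' Z" "p \<in> W'" "Z p = w"
      by (rule local_vector_field)
    let ?W = "U \<inter> W \<inter> W'"
    have "open ?W" using X Y Z by (simp add: vector_field_on_def open_Int)
    then have fields: "vector_field_on A ?W X" "vector_field_on A ?W Y" "vector_field_on A ?W Z"
      using X(1) Y Z(1) by (blast intro: vector_field_on_subset)+
    have "p \<in> ?W" using p X Z by simp
    note sym = S_sym[OF _ _ this] and skew = S_skew[OF _ _ _ this]
    \<comment> \<open>Alternating the two rules leads back to the arguments \<open>X, Y, Z\<close> after three swaps of each kind,
      hence with the opposite sign.\<close>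
    have "g' p (S X Y) (Z p) = - g' p (S X Y) (Z p)"
      using skew[of X Y Z] skew[of Z X Y] skew[of Y Z X] sym[of X Y] sym[of X Z] sym[of Y Z] fields
      by simp
    then show ?thesis by (simp add: deformed.g_linear Z(3))
  qed
  then have "S X Y = 0" by (rule deformed.g_nondegenerate)
  then show ?thesis by (simp add: S_def X(3) algebra_simps)
qed

lemma D'_\<xi>: "D' \<xi> p v = v - \<eta> p v *\<^sub>R \<xi> p"
  using deformed_connection[OF vector_field_\<xi> UNIV_I] by (simp add: D_\<xi>)

lemma g'_\<xi>: "g' p v (\<xi> p) = a\<^sup>2 * \<eta> p v"
  by (simp add: g'_eq power2_eq_square algebra_simps)

text \<open>Since \<open>\<nabla>'\<^sub>\<xi> \<xi> = 0\<close> and \<open>\<nabla>'\<^sub>X \<xi> = X - \<eta>(X) \<xi>\<close>, the curvature is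
  \<open>- \<nabla>'\<^sub>\<xi> (X - \<eta>(X) \<xi>) - \<nabla>'\<^bsub>[X,\<xi>]\<^esub> \<xi>\<close>. The bracket is \<open>X - \<nabla>'\<^sub>\<xi> X\<close> at \<open>p\<close>, so that the derivatives of
  \<open>X\<close> along \<open>\<xi>\<close> cancel. The field \<open>X\<close> is horizontal only at \<open>p\<close>, so the derivative of \<open>\<eta>(X)\<close> along \<open>\<xi>\<close>
  has to be kept; it cancels against the \<open>\<xi>\<close>-component of the bracket.\<close>

lemma deformed_curvature_\<xi>:
  assumes X: "vector_field_on A U X" and p: "p \<in> U" and horizontal: "\<eta> p (X p) = 0"
  shows "curvature A D' X \<xi> \<xi> p = - X p"
proof -
  have U: "open U" by (rule vector_field_on_open[OF X])
  note \<xi> = vector_field_on_\<xi>[OF U]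
  let ?k = "\<lambda>q. - \<eta> q (X q)"
  have k: "smooth_fun_on A U ?k"
    using smooth_fun_on_mult[OF smooth_fun_on_const[OF U, of "- 1"] smooth_fun_on_\<eta>[OF X]] by simp
  have Y: "vector_field_on A U (\<lambda>q. ?k q *\<^sub>R \<xi> q)"
    by (rule vector_field_on_scaleR[OF k \<xi>])
  have cov_\<xi>: "cov D' X \<xi> = (\<lambda>q. X q + ?k q *\<^sub>R \<xi> q)" "cov D' \<xi> \<xi> = (\<lambda>q. 0)"
    by (auto simp: cov_def D'_\<xi>)
  have dk: "differential A ?k p v = - (g p v (X p) + \<eta> p (D X p v))" for v
    using differential_cmult[OF smooth_fun_on_\<eta>[OF X] p, of "- 1"] differential_\<eta>[OF X p]
    by (simp add: horizontal)
  have "D' (\<lambda>q. X q + ?k q *\<^sub>R \<xi> q) p (\<xi> p) = D' X p (\<xi> p) - \<eta> p (D X p (\<xi> p)) *\<^sub>R \<xi> p"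
    using connection_add[OF deformed.affine X Y p] connection_scaleR[OF deformed.affine k \<xi> p]
    by (simp add: dk horizontal D'_\<xi>)
  moreover have "D' X p (\<xi> p) = D X p (\<xi> p)"
    by (simp add: deformed_connection[OF X p])
  ultimately show ?thesis
    unfolding curvature_def cov_\<xi>
    by (simp add: cov_def connection_zero[OF deformed.affine] deformed.lie_bracket_eq[OF X \<xi> p]
        D'_\<xi> horizontal \<eta>_simps algebra_simps)
qed

lemma grad_eq:
  assumes "smooth_fun A f"
  shows "grad A g f p = a *\<^sub>R grad A g' f p + (a * (a - 1) * \<eta> p (grad A g' f p)) *\<^sub>R \<xi> p"
  using deformed.g_grad[OF assms] by (intro grad_eqI[OF assms]) (simp add: g_linear g'_eq)

lemma vector_field_grad:
  assumes f: "smooth_fun A f" and V: "vector_field A (grad A g' f)"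
  shows "vector_field A (grad A g f)"
proof -
  note const = smooth_fun_on_const[OF open_UNIV]
  have "vector_field A (\<lambda>p. a *\<^sub>R grad A g' f p + (a * (a - 1) * \<eta> p (grad A g' f p)) *\<^sub>R \<xi> p)"
    by (intro vector_field_on_add vector_field_on_scaleR vector_field_\<xi> smooth_fun_on_mult const
        smooth_fun_on_\<eta> V)
  then show ?thesis by (simp add: grad_eq[OF f, abs_def])
qed

text \<open>Both \<open>g(grad f, X)\<close> and \<open>g'(grad' f, X)\<close> are the function \<open>df(X)\<close>; differentiating it along
  \<open>X\<close> in both ways leaves the difference of the two connections.\<close>

lemma deformed_hessian:
  assumes f: "smooth_fun A f" and V: "vector_field A (grad A g' f)"
  shows "hess A g' D' f p v v =
    hess A g D f p v v - (a - 1) / a * (g p v v - (\<eta> p v)\<^sup>2) * \<eta> p (grad A g f p)"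
proof -
  obtain U X where X: "vector_field_on A U X" "p \<in> U" "X p = v"
    by (rule local_vector_field)
  have U: "open U" by (rule vector_field_on_open[OF X(1)])
  have V': "vector_field_on A U (grad A g' f)" "vector_field_on A U (grad A g f)"
    using vector_field_on_subset[OF _ U] V vector_field_grad[OF f V] by auto
  let ?d = "differential A (\<lambda>q. differential A f q (X q)) p v"
  have "hess A g D f p v v + differential A f p (D X p v) = ?d"
    using differential_g[OF V'(2) X(1,2), of v] by (simp add: hess_def g_grad[OF f] X(3))
  moreover have "hess A g' D' f p v v + differential A f p (D' X p v) = ?d"
    using deformed.differential_g[OF V'(1) X(1,2), of v] by (simp add: hess_def deformed.g_grad[OF f] X(3))
  ultimately show ?thesis
    unfolding deformed_connection[OF X(1,2)] g_grad[OF f, symmetric]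
    by (simp add: g_linear X(3) power2_eq_square)
qed

text \<open>The soliton equation evaluated at \<open>(v, \<xi>, \<xi>, v)\<close>: all mixed terms \<open>g'(v,\<xi>)\<close> of the Kulkarni-Nomizu
  products vanish for horizontal \<open>v\<close>, and the curvature term is \<open>- g'(v,v)\<close>. So the Hessian of \<open>f\<close> is a
  multiple of \<open>g\<close> on horizontal vectors, with a factor that involves the soliton function.\<close>

lemma soliton_horizontal:
  assumes f: "smooth_fun A f" and sol: "almost_riemann_soliton A g' D' (grad A g' f) lam"
    and horizontal: "\<eta> p v = 0"
  shows "hess A g D f p v v =
    (lam p * a + (a - 1) / a * \<eta> p (grad A g f p) - hess A g D f p (\<xi> p) (\<xi> p) / a + 1 / a) * g p v v"
proof -
  let ?V = "grad A g' f" and ?H = "hess A g' D' f p"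
  have V: "vector_field A ?V" using sol by (simp add: almost_riemann_soliton_def)
  obtain U X where X: "vector_field_on A U X" "p \<in> U" "X p = v"
    by (rule local_vector_field)
  have U: "open U" by (rule vector_field_on_open[OF X(1)])
  have VU: "vector_field_on A U ?V" using vector_field_on_subset[OF V U] by simp
  note \<xi> = vector_field_on_\<xi>[OF U]
  have "kulkarni_nomizu (\<lambda>X Y p. 1/2 * lie_derivative A ?V g' X Y p) (as_tensor g') X \<xi> \<xi> X p
      + g' p (curvature A D' X \<xi> \<xi> p) (X p)
      = lam p / 2 * kulkarni_nomizu (as_tensor g') (as_tensor g') X \<xi> \<xi> X p"
    by (rule sol[unfolded almost_riemann_soliton_def, THEN conjunct2, THEN conjunct2, THEN conjunct2,
          THEN conjunct2, THEN conjunct2, rule_format, OF conjI[OF X(1) conjI[OF \<xi> conjI[OF \<xi> X(1)]]] X(2)])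
  moreover have "lie_derivative A ?V g' X X p = 2 * ?H v v"
    using deformed.lie_derivative_g[OF VU X(1) X(1,2)] X(3) by (simp add: hess_def deformed.g_sym[of p v])
  moreover have "lie_derivative A ?V g' \<xi> \<xi> p = 2 * ?H (\<xi> p) (\<xi> p)"
    using deformed.lie_derivative_g[OF VU \<xi> \<xi> X(2)] by (simp add: hess_def deformed.g_sym[of p "\<xi> p"])
  moreover have "curvature A D' X \<xi> \<xi> p = - v"
    using deformed_curvature_\<xi>[OF X(1,2)] X(3) horizontal by simp
  moreover have "g' p v v = a * g p v v" "g' p (\<xi> p) v = 0"
    using horizontal by (simp_all add: g'_eq)
  ultimately have "a\<^sup>2 * ?H v v + a * g p v v * ?H (\<xi> p) (\<xi> p) - a * g p v v = lam p * a ^ 3 * g p v v"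
    by (simp add: kulkarni_nomizu_def as_tensor_def X(3) g'_\<xi> horizontal deformed.g_linear
        power2_eq_square power3_eq_cube algebra_simps)
  then have "a * ?H v v + g p v v * ?H (\<xi> p) (\<xi> p) - g p v v = lam p * a\<^sup>2 * g p v v"
    using a_pos by (simp add: power2_eq_square power3_eq_cube algebra_simps)
      (metis less_irrefl mult_left_cancel distrib_left mult.left_commute)
  then show ?thesis
    using a_pos deformed_hessian[OF f V, of p v] deformed_hessian[OF f V, of p "\<xi> p"] horizontal
    by (simp add: field_simps power2_eq_square)
qed

end

theorem theorem3p7:
  fixes A :: "('m::{t2_space, second_countable_topology}, 'e::euclidean_space) chart set"
    and \<phi> \<phi>' :: "'m \<Rightarrow> 'e \<Rightarrow> 'e" and \<xi> \<xi>' :: "'m \<Rightarrow> 'e" and \<eta> \<eta>' :: "'m \<Rightarrow> 'e \<Rightarrow> real"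
    and g g' :: "'m \<Rightarrow> 'e \<Rightarrow> 'e \<Rightarrow> real"
    and D D' :: "('m, 'e) connection"
    and f lam :: "'m \<Rightarrow> real" and a :: real and n :: nat
  assumes "smooth_atlas A" and "DIM('e) = 2 * n + 1" and "n \<ge> 1"
    and "kenmotsu A \<phi> \<xi> \<eta> g D"
    and "a > 0"
    and "(\<phi>', \<xi>', \<eta>', g') = d_homothetic a (\<phi>, \<xi>, \<eta>, g)"
    and "smooth_fun A f"
    and "almost_riemann_soliton A g' D' (grad A g' f) lam"
  shows "\<forall>p. lam p =
      1 / (2 * real n * a) * laplacian A g D f p
      - (a - 1) / a\<^sup>2 * \<eta> p (grad A g f p)
      + (2 * real n - a) / (2 * real n * a\<^sup>2) * hess A g D f p (\<xi> p) (\<xi> p)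
      - 1 / a\<^sup>2"
proof
  fix p
  interpret deformed_kenmotsu_manifold A g D \<phi> \<xi> \<eta> g' D' a
  proof unfold_locales
    show "smooth_atlas A" "kenmotsu A \<phi> \<xi> \<eta> g D" "a > 0" by fact+
    then show "riemannian_metric A g" "levi_civita A g D"
      by (simp_all add: kenmotsu_def almost_contact_metric_def)
    show "riemannian_metric A g'" "levi_civita A g' D'"
      using assms(8) by (simp_all add: almost_riemann_soliton_def)
    show "g' p u v = a * g p u v + a * (a - 1) * \<eta> p u * \<eta> p v" for p u v
      using assms(6) by (simp add: d_homothetic_def)
  qed
  note f = assms(7) and sol = assms(8)
  let ?L = "D (grad A g f) p" and ?H = "hess A g D f p (\<xi> p) (\<xi> p)" and ?e = "\<eta> p (grad A g f p)"
  let ?\<mu> = "lam p * a + (a - 1) / a * ?e - ?H / a + 1 / a"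
  have "vector_field A (grad A g' f)"
    using sol by (simp add: almost_riemann_soliton_def)
  then have "linear ?L"
    by (intro D_linear[OF vector_field_grad[OF f]]) simp_all
  moreover have "g p (?L v) v = ?\<mu> * g p v v" if "\<eta> p v = 0" for v
    using soliton_horizontal[OF f sol that] by (simp add: hess_def)
  ultimately have "(\<Sum>b\<in>Basis. ?L b \<bullet> b) = (real DIM('e) - 1) * ?\<mu> + g p (?L (\<xi> p)) (\<xi> p)"
    by (rule trace_of_horizontally_scalar)
  then have \<Delta>: "laplacian A g D f p = 2 * real n * ?\<mu> + ?H"
    unfolding laplacian_def divergence_def hess_def assms(2) by simp
  show "lam p = 1 / (2 * real n * a) * laplacian A g D f p - (a - 1) / a\<^sup>2 * ?e
      + (2 * real n - a) / (2 * real n * a\<^sup>2) * ?H - 1 / a\<^sup>2"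
    using assms(3,5) by (simp add: \<Delta> field_simps power2_eq_square)
qed

end
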